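(* Let $A,B,H,K$ be any logically independent events. The set $\Pi$ of all the coherent assessments $(x,y,z,\mu)$ on the family $\mathcal{F}=\{A|H,\ B|K,\ (A|H)\wedge_{B}(B|K),\ (B|K)|_{B}(A|H)\}$ is $\Pi=\Pi'\cup\Pi''$, where $$\Pi'=\{(x,y,z,\mu): x\in(0,1],\ y\in[0,1],\ z\in[z',z''],\ \mu=\tfrac{z}{x}\},$$ with $z'=0$, $z''=1$, and $\Pi''=\{(0,y,0,\mu):(y,\mu)\in[0,1]^2\}$.
   Context: Events are two-valued entities identified with their indicators (values $1/0$); $\emptyset$ is the impossible event, $AB=A\wedge B$, $\overline{A}$ is the negation. Four events are logically independent if all $16$ conjunctions obtained by taking each event or its negation are different from $\emptyset$. For $H\neq\emptyset$ the conditional event $E|H$ is true if $EH$ is true, false if $\overline{E}H$ is true, void if $\overline{H}$ is true. Once $P(E|H)=p$ is assessed, $E|H$ is also the random quantity $EH+p\overline{H}$; numerically $\overline{A}|H=1-A|H$. Bochvar–Kleene conjunction (a conditional event; the subscript $B$ is only a name, unrelated to the event $B$): $(A|H)\wedge_B(B|K)=AHBK|HK$. Iterated conditional: $(B|K)|_B(A|H)$ is the random quantity $(A|H)\wedge_B(B|K)+\mu\,(\overline{A}|H)$, where $\mu=\mathbb{P}[(B|K)|_B(A|H)]$ is its assessed prevision (the amount paid to receive it), the right-hand side being computed numerically from $x=P(A|H)$, $z=P[(A|H)\wedge_B(B|K)]$ and $\mu$. Also $y=P(B|K)$. Coherence: an assessment of real values $m_j$ on a finite family of such objects $X_j$ (conditional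 events, as random quantities, and iterated conditionals) is coherent iff for every nonempty subfamily $J$ and all reals $s_j$, the random gain $\sum_{j\in J}s_j(X_j-m_j)$, restricted to the cases where at least one of the bets in $J$ is not called off, has minimum $\le 0$ and maximum $\ge 0$. A bet on a conditional event is called off when it is void; a bet on the iterated conditional is called off in the cases where one receives back the paid amount $\mu$ whatever $\mu$ is (taking into account the relation $z=x\mu$ required by linearity of coherent previsions). *)

theory Defs
  imports Complex_Main "HOL-Library.Indicator_Function"
begin

text \<open>
  Events are sets of elementary cases, \<open>{}\<close> is the impossible event, and the value of an
  event is its indicator.
\<close>

definition logically_independent :: "'w set \<Rightarrow> 'w set \<Rightarrow> 'w set \<Rightarrow> 'w set \<Rightarrow> bool" where
  "logically_independent A B H K \<longleftrightarrow>
     (\<forall>A' \<in> {A, - A}. \<forall>B' \<in> {B, - B}. \<forall>H' \<in> {H, - H}. \<forall>K' \<in> {K, - K}.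
        A' \<inter> B' \<inter> H' \<inter> K' \<noteq> {})"

text \<open>\<open>E \<parallel> H\<close> is the conditional event ``\<open>E\<close> given \<open>H\<close>''; it is meaningful for \<open>H \<noteq> {}\<close> only.\<close>

datatype 'w cond_event = Given "'w set" "'w set" (infix "\<parallel>" 75)

fun ce_void :: "'w cond_event \<Rightarrow> 'w set" where
  "ce_void (E \<parallel> H) = - H"

fun ce_neg :: "'w cond_event \<Rightarrow> 'w cond_event" where
  "ce_neg (E \<parallel> H) = (- E) \<parallel> H"

fun bochvar_conj :: "'w cond_event \<Rightarrow> 'w cond_event \<Rightarrow> 'w cond_event"
    (infixl "\<and>\<^sub>B" 70) where
  "(A \<parallel> H) \<and>\<^sub>B (B \<parallel> K) = (A \<inter> H \<inter> B \<inter> K) \<parallel> (H \<inter> K)"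

text \<open>The random quantity of a conditional event assessed with probability \<open>p\<close>.\<close>

fun ce_quantity :: "'w cond_event \<Rightarrow> real \<Rightarrow> 'w \<Rightarrow> real" where
  "ce_quantity (E \<parallel> H) p \<omega> = indicator (E \<inter> H) \<omega> + p * indicator (- H) \<omega>"

lemma ce_quantity_neg: "ce_quantity (ce_neg a) (1 - x) \<omega> = 1 - ce_quantity a x \<omega>"
  by (cases a) (auto simp: indicator_def)

text \<open>
  The iterated conditional of \<open>b\<close> given \<open>a\<close>, where \<open>x\<close> is the probability of \<open>a\<close>, \<open>z\<close> that
  of \<open>a \<and>\<^sub>B b\<close>, and \<open>\<mu>\<close> the prevision of the iterated conditional itself.
\<close>

definition iter_quantity ::
  "'w cond_event \<Rightarrow> 'w cond_event \<Rightarrow> real \<Rightarrow> real \<Rightarrow> real \<Rightarrow> 'w \<Rightarrow> real" where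
  "iter_quantity b a x z \<mu> \<omega> =
     ce_quantity (a \<and>\<^sub>B b) z \<omega> + \<mu> * ce_quantity (ce_neg a) (1 - x) \<omega>"

text \<open>The objects on which one can bet; \<open>b |\<^sub>B a\<close> is the iterated conditional of \<open>b\<close> given \<open>a\<close>.\<close>

datatype 'w bet =
    Cond "'w cond_event"
  | Iter "'w cond_event" "'w cond_event" (infix "|\<^sub>B" 65)

text \<open>
  An assessment \<open>m\<close> assigns a real to each object.  The quantity of an iterated conditional
  \<open>b |\<^sub>B a\<close> also uses the values assessed for \<open>a\<close> and \<open>a \<and>\<^sub>B b\<close>, so a family containing
  \<open>b |\<^sub>B a\<close> should contain these two as well.
\<close>

fun quantity :: "('w bet \<Rightarrow> real) \<Rightarrow> 'w bet \<Rightarrow> 'w \<Rightarrow> real" where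
  "quantity m (Cond a) = ce_quantity a (m (Cond a))"
| "quantity m (b |\<^sub>B a) =
     iter_quantity b a (m (Cond a)) (m (Cond (a \<and>\<^sub>B b))) (m (b |\<^sub>B a))"

text \<open>
  A bet on \<open>b |\<^sub>B a\<close> is called off in the cases where the paid amount \<open>\<nu>\<close> is received back
  whatever \<open>\<nu>\<close> is, the probability \<open>x\<close> of \<open>a\<close> being fixed and that of \<open>a \<and>\<^sub>B b\<close> being
  \<open>x * \<nu>\<close>, as linearity requires.  The resulting cases are listed in \<open>called_off_iter\<close> below.
\<close>

fun called_off :: "('w bet \<Rightarrow> real) \<Rightarrow> 'w bet \<Rightarrow> 'w set" where
  "called_off m (Cond a) = ce_void a"
| "called_off m (b |\<^sub>B a) =
     {\<omega>. \<forall>\<nu>. iter_quantity b a (m (Cond a)) (m (Cond a) * \<nu>) \<nu> \<omega> = \<nu>}"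

lemma called_off_iter:
  "called_off m ((B \<parallel> K) |\<^sub>B (A \<parallel> H)) =
     - H \<union> (- A \<inter> H \<inter> K)
     \<union> (if m (Cond (A \<parallel> H)) = 1 then A \<inter> H \<inter> - K else {})
     \<union> (if m (Cond (A \<parallel> H)) = 0 then - A \<inter> H \<inter> - K else {})"
    (is "_ = ?R")
proof (rule set_eqI)
  fix \<omega>
  define x where "x = m (Cond (A \<parallel> H))"
  have *: "(\<forall>\<nu>::real. x * \<nu> = \<nu>) \<longleftrightarrow> x = 1"
    by (metis mult.right_neutral mult_1)
  have **: "(\<forall>\<nu>::real. x * \<nu> + \<nu> = \<nu>) \<longleftrightarrow> x = 0"
    by (metis add_cancel_left_left mult.right_neutral mult_zero_left)
  have one: "\<not> (\<forall>\<nu>::real. 1 = \<nu>)" "\<not> (\<forall>\<nu>::real. 0 = \<nu>)"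
    by (metis zero_neq_one)+
  show "\<omega> \<in> called_off m ((B \<parallel> K) |\<^sub>B (A \<parallel> H)) \<longleftrightarrow> \<omega> \<in> ?R"
    using * ** one
    by (cases "\<omega> \<in> A"; cases "\<omega> \<in> B"; cases "\<omega> \<in> H"; cases "\<omega> \<in> K")
       (simp_all add: iter_quantity_def x_def[symmetric] algebra_simps)
qed

definition gain :: "('w bet \<Rightarrow> real) \<Rightarrow> 'w bet set \<Rightarrow> ('w bet \<Rightarrow> real) \<Rightarrow> 'w \<Rightarrow> real" where
  "gain m J s \<omega> = (\<Sum>X\<in>J. s X * (quantity m X \<omega> - m X))"

text \<open>
  \<open>Min\<close> and \<open>Max\<close> below are genuine extrema: a gain takes finitely many values only
  (\<open>finite_range_gain\<close>), and \<open>active\<close> is nonempty unless every bet in \<open>J\<close> is degenerate.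
\<close>

definition coherent :: "'w bet set \<Rightarrow> ('w bet \<Rightarrow> real) \<Rightarrow> bool" where
  "coherent F m \<longleftrightarrow>
     (\<forall>J s. J \<subseteq> F \<and> finite J \<and> J \<noteq> {} \<longrightarrow>
        (let active = {\<omega>. \<exists>X\<in>J. \<omega> \<notin> called_off m X}
         in Min (gain m J s ` active) \<le> 0 \<and> 0 \<le> Max (gain m J s ` active)))"

lemma finite_range_ce_quantity: "finite (range (ce_quantity a p))"
proof (cases a)
  case (Given E H)
  have "range (ce_quantity a p) \<subseteq> {0, 1, p}"
    by (auto simp: Given indicator_def)
  then show ?thesis
    by (rule finite_subset) simp
qed

lemma finite_range_quantity: "finite (range (quantity m X))"
proof (cases X)
  case (Cond a)
  then show ?thesis by (simp add: finite_range_ce_quantity)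
next
  case (Iter b a)
  define f where "f = ce_quantity (a \<and>\<^sub>B b) (m (Cond (a \<and>\<^sub>B b)))"
  define g where "g = ce_quantity (ce_neg a) (1 - m (Cond a))"
  have "range (quantity m X) \<subseteq>
      (\<lambda>(u, v). u + m (Iter b a) * v) ` (range f \<times> range g)"
    by (auto simp: Iter iter_quantity_def f_def g_def)
  moreover have "finite (range f \<times> range g)"
    by (simp add: f_def g_def finite_range_ce_quantity)
  ultimately show ?thesis
    by (meson finite_imageI finite_subset)
qed

lemma finite_range_gain: "finite J \<Longrightarrow> finite (range (gain m J s))"
proof (induction J rule: finite_induct)
  case empty
  then show ?case by (simp add: gain_def)
next
  case (insert X J)
  have "range (gain m (insert X J) s) \<subseteq>
      (\<lambda>(u, v). s X * (u - m X) + v) ` (range (quantity m X) \<times> range (gain m J s))"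
    using insert.hyps by (auto simp: gain_def)
  moreover have "finite (range (quantity m X) \<times> range (gain m J s))"
    using insert.IH by (simp add: finite_range_quantity)
  ultimately show ?case
    by (meson finite_imageI finite_subset)
qed

definition coherent_assessments ::
  "'w bet \<times> 'w bet \<times> 'w bet \<times> 'w bet \<Rightarrow> (real \<times> real \<times> real \<times> real) set" where
  "coherent_assessments = (\<lambda>(X1, X2, X3, X4).
     {(m X1, m X2, m X3, m X4) | m. coherent {X1, X2, X3, X4} m})"

end

theory Submission imports Defs begin

text \<open>
  Write \<open>g\<^sub>1, g\<^sub>2, g\<^sub>3, g\<^sub>4\<close> for the net gains (quantity minus assessed value) of
  \<open>A|H\<close>, \<open>B|K\<close>, their conjunction and the iterated conditional.  The defining equation of the
  iterated conditional says, case by case, that \<open>g\<^sub>4 = g\<^sub>3 - \<mu> g\<^sub>1 + (z - x \<mu>)\<close>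
  (\<open>iterated_net_gain\<close>), and everything follows from this identity.

  Necessity: buying the iterated conditional, selling the conjunction and buying \<open>\<mu>\<close> units of
  \<open>A|H\<close> yields \<open>z - x \<mu>\<close> for certain, so \<open>z = x \<mu>\<close>.  Bets on single conditional events put
  \<open>x\<close>, \<open>y\<close>, \<open>z\<close> into the unit interval.  If \<open>x > 0\<close>, this determines \<open>\<mu> = z / x\<close>, possibly
  above 1; if \<open>x = 0\<close>, then \<open>z = 0\<close> and the single bet on the iterated conditional
  behaves, where it is not called off, like a bet on an event, whence \<open>\<mu>\<close> lies in the unit
  interval.

  Sufficiency: for each subfamily \<open>J\<close> it is enough to find a probability distribution on the
  active cases under which all net gains of \<open>J\<close> have expectation zero
  (\<open>coherentI_balanced\<close>).  The distribution may depend on \<open>J\<close>, and this is why the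
  conjunction imposes no bound on \<open>z\<close> beyond \<open>0 \<le> z \<le> 1\<close>: it is void outside \<open>H \<inter> K\<close>, so as
  soon as \<open>A|H\<close> or \<open>B|K\<close> belongs to \<open>J\<close>, all mass can be put on \<open>H - K\<close> or \<open>K - H\<close>, where the
  value \<open>z\<close> is never tested.  Because \<open>z = x \<mu>\<close>, the gain \<open>g\<^sub>4\<close> is balanced whenever \<open>g\<^sub>1\<close>
  and \<open>g\<^sub>3\<close> are.
\<close>

section \<open>Coherence and balanced distributions\<close>

lemma coherentD:
  assumes "coherent F m" "J \<subseteq> F" "finite J" "\<omega>\<^sub>0 \<in> active"
    and active: "active = {\<omega>. \<exists>X\<in>J. \<omega> \<notin> called_off m X}"
  shows "\<exists>\<omega>\<in>active. gain m J s \<omega> \<le> 0" "\<exists>\<omega>\<in>active. 0 \<le> gain m J s \<omega>"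
proof -
  let ?G = "gain m J s ` active"
  have fin: "finite ?G"
    using finite_range_gain[OF \<open>finite J\<close>] by (rule finite_subset[rotated]) auto
  have ne: "?G \<noteq> {}" "J \<noteq> {}" using assms by auto
  have "Min ?G \<le> 0 \<and> 0 \<le> Max ?G"
    using assms(1-3) ne(2) unfolding coherent_def Let_def active by blast
  with Min_in[OF fin ne(1)] Max_in[OF fin ne(1)]
  show "\<exists>\<omega>\<in>active. gain m J s \<omega> \<le> 0" "\<exists>\<omega>\<in>active. 0 \<le> gain m J s \<omega>"
    by auto
qed

lemma coherent_singletonD:
  assumes "coherent F m" "X \<in> F" "\<omega>\<^sub>0 \<notin> called_off m X"
  shows "\<exists>\<omega>. \<omega> \<notin> called_off m X \<and> quantity m X \<omega> \<le> m X"
    and "\<exists>\<omega>. \<omega> \<notin> called_off m X \<and> m X \<le> quantity m X \<omega>"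
  using coherentD[OF assms(1), of "{X}" \<omega>\<^sub>0 _ "\<lambda>_. 1"] assms(2,3)
  by (auto simp: gain_def)

text \<open>
  The easy half of the duality between bets and expectations: under a distribution (given by
  weighted points, repetitions allowed) that balances every bet of \<open>J\<close>, each combined gain has
  expectation zero, so it cannot have a constant strict sign on the support.
\<close>

lemma coherentI_balanced:
  assumes "\<And>J. J \<subseteq> F \<Longrightarrow> J \<noteq> {} \<Longrightarrow> \<exists>ps.
      (\<forall>(w, \<omega>) \<in> set ps. 0 \<le> w \<and> (\<exists>X\<in>J. \<omega> \<notin> called_off m X)) \<and>
      0 < (\<Sum>(w, \<omega>)\<leftarrow>ps. w) \<and>
      (\<forall>X\<in>J. (\<Sum>(w, \<omega>)\<leftarrow>ps. w * (quantity m X \<omega> - m X)) = 0)"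
  shows "coherent F m"
  unfolding coherent_def Let_def
proof (intro allI impI)
  fix J and s :: "'a bet \<Rightarrow> real"
  assume J: "J \<subseteq> F \<and> finite J \<and> J \<noteq> {}"
  define G where "G = gain m J s ` {\<omega>. \<exists>X\<in>J. \<omega> \<notin> called_off m X}"
  obtain ps where ps: "\<And>w \<omega>. (w, \<omega>) \<in> set ps \<Longrightarrow> 0 \<le> w \<and> gain m J s \<omega> \<in> G"
    and pos: "0 < (\<Sum>(w, \<omega>)\<leftarrow>ps. w)"
    and bal: "\<And>X. X \<in> J \<Longrightarrow> (\<Sum>(w, \<omega>)\<leftarrow>ps. w * (quantity m X \<omega> - m X)) = 0"
  proof -
    from assms[of J] J obtain ps
      where *: "\<forall>(w, \<omega>) \<in> set ps. 0 \<le> w \<and> (\<exists>X\<in>J. \<omega> \<notin> called_off m X)"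
        and "0 < (\<Sum>(w, \<omega>)\<leftarrow>ps. w)"
        and "\<forall>X\<in>J. (\<Sum>(w, \<omega>)\<leftarrow>ps. w * (quantity m X \<omega> - m X)) = 0"
      by blast
    moreover have "0 \<le> w \<and> gain m J s \<omega> \<in> G" if "(w, \<omega>) \<in> set ps" for w \<omega>
      using * that unfolding G_def by blast
    ultimately show ?thesis using that by blast
  qed
  have fin: "finite G"
    unfolding G_def using finite_range_gain J by (meson finite_subset image_mono subset_UNIV)
  have "(\<Sum>(w, \<omega>)\<leftarrow>ps. w * gain m J s \<omega>)
      = (\<Sum>X\<in>J. s X * (\<Sum>(w, \<omega>)\<leftarrow>ps. w * (quantity m X \<omega> - m X)))"
  proof (induction ps)
    case (Cons p ps)
    then show ?case
      by (cases p) (simp add: gain_def sum_distrib_left sum.distrib distrib_left mult.left_commute)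
  qed simp
  also have "\<dots> = 0" using bal by simp
  finally have zero: "(\<Sum>(w, \<omega>)\<leftarrow>ps. w * gain m J s \<omega>) = 0" .
  have bounds: "Min G * w \<le> w * gain m J s \<omega>" "w * gain m J s \<omega> \<le> Max G * w"
    if "(w, \<omega>) \<in> set ps" for w \<omega>
    using ps[OF that] Min_le[OF fin] Max_ge[OF fin]
    by (simp_all add: mult.commute[of w] mult_right_mono)
  have "(\<Sum>(w, \<omega>)\<leftarrow>ps. w * gain m J s \<omega>) \<le> (\<Sum>(w, \<omega>)\<leftarrow>ps. Max G * w)"
    using bounds by (intro sum_list_mono) auto
  moreover have "(\<Sum>(w, \<omega>)\<leftarrow>ps. Min G * w) \<le> (\<Sum>(w, \<omega>)\<leftarrow>ps. w * gain m J s \<omega>)"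
    using bounds by (intro sum_list_mono) auto
  moreover have "(\<Sum>(w, \<omega>)\<leftarrow>ps. c * w) = c * (\<Sum>(w, \<omega>)\<leftarrow>ps. w)" for c
    by (simp add: sum_list_const_mult[symmetric] case_prod_unfold)
  ultimately have "0 \<le> Max G" "Min G \<le> 0"
    using pos zero by (auto simp: zero_le_mult_iff mult_le_0_iff)
  then show "Min (gain m J s ` {\<omega>. \<exists>X\<in>J. \<omega> \<notin> called_off m X}) \<le> 0 \<and>
      0 \<le> Max (gain m J s ` {\<omega>. \<exists>X\<in>J. \<omega> \<notin> called_off m X})"
    by (simp add: G_def)
qed

section \<open>Necessary conditions\<close>

lemma iterated_net_gain:
  "quantity m (b |\<^sub>B a) \<omega> - m (b |\<^sub>B a) =
     (quantity m (Cond (a \<and>\<^sub>B b)) \<omega> - m (Cond (a \<and>\<^sub>B b)))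
     - m (b |\<^sub>B a) * (quantity m (Cond a) \<omega> - m (Cond a))
     + (m (Cond (a \<and>\<^sub>B b)) - m (Cond a) * m (b |\<^sub>B a))"
  by (simp add: iter_quantity_def ce_quantity_neg algebra_simps)

lemma coherent_probability_bounds:
  assumes "coherent F m" "Cond (E \<parallel> H) \<in> F" "H \<noteq> {}"
  shows "m (Cond (E \<parallel> H)) \<in> {0..1}"
proof -
  let ?X = "Cond (E \<parallel> H)"
  obtain \<omega>\<^sub>0 where "\<omega>\<^sub>0 \<notin> called_off m ?X" using assms(3) by auto
  from coherent_singletonD[OF assms(1,2) this] show ?thesis
    by (auto intro: order_trans[OF indicator_pos_le] order_trans[OF _ indicator_le_1])
qed

text \<open>
  The bets that replicate the iterated conditional leave a riskless remainder, which coherence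
  forces to vanish.  The hypothesis \<open>a \<and>\<^sub>B b \<noteq> a\<close> lets the two conditional events be staked
  separately.
\<close>

lemma coherent_product_rule:
  assumes coh: "coherent F m" and F: "{Cond a, Cond (a \<and>\<^sub>B b), b |\<^sub>B a} \<subseteq> F"
    and ne: "a \<and>\<^sub>B b \<noteq> a" "ce_void a \<noteq> UNIV"
  shows "m (Cond (a \<and>\<^sub>B b)) = m (Cond a) * m (b |\<^sub>B a)"
proof -
  let ?J = "{Cond a, Cond (a \<and>\<^sub>B b), b |\<^sub>B a}"
  define s where "s X = (if X = Cond a then m (b |\<^sub>B a)
      else if X = Cond (a \<and>\<^sub>B b) then -1 else 1)" for X
  have const: "gain m ?J s \<omega> = m (Cond (a \<and>\<^sub>B b)) - m (Cond a) * m (b |\<^sub>B a)" for \<omega>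
    using ne(1) iterated_net_gain[of m b a \<omega>]
    by (simp add: gain_def s_def del: quantity.simps)
  obtain \<omega>\<^sub>0 where "\<omega>\<^sub>0 \<in> {\<omega>. \<exists>X\<in>?J. \<omega> \<notin> called_off m X}"
    using ne(2) by auto
  from coherentD[OF coh F _ this refl, of s] show ?thesis
    by (simp add: const del: called_off.simps)
qed

text \<open>
  With \<open>x = z = 0\<close> the iterated conditional takes only the values \<open>0\<close> and \<open>1\<close> in the
  cases where the bet on it stands; hence \<open>\<mu>\<close> is squeezed between them.
\<close>

lemma coherent_iterated_bounds:
  assumes coh: "coherent F m" and F: "(B \<parallel> K) |\<^sub>B (A \<parallel> H) \<in> F"
    and "A \<inter> H \<inter> K \<noteq> {}"
    and zero: "m (Cond (A \<parallel> H)) = 0" "m (Cond ((A \<parallel> H) \<and>\<^sub>B (B \<parallel> K))) = 0"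
  shows "m ((B \<parallel> K) |\<^sub>B (A \<parallel> H)) \<in> {0..1}"
proof -
  let ?X = "(B \<parallel> K) |\<^sub>B (A \<parallel> H)"
  have val: "quantity m ?X \<omega> \<in> {0, 1}" if "\<omega> \<notin> called_off m ?X" for \<omega>
    using that zero unfolding called_off_iter by (auto simp: iter_quantity_def indicator_def)
  obtain \<omega>\<^sub>0 where "\<omega>\<^sub>0 \<notin> called_off m ?X"
    using assms(3) zero unfolding called_off_iter by auto
  from coherent_singletonD[OF coh F this] show ?thesis
    using val by fastforce
qed

section \<open>Coherence for logically independent events\<close>

lemma logically_independentD:
  assumes "logically_independent A B H K"
  shows "\<exists>\<omega>. (\<omega> \<in> A \<longleftrightarrow> a) \<and> (\<omega> \<in> B \<longleftrightarrow> b) \<and> (\<omega> \<in> H \<longleftrightarrow> h) \<and> (\<omega> \<in> K \<longleftrightarrow> k)"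
proof -
  have "(if a then A else - A) \<inter> (if b then B else - B)
      \<inter> (if h then H else - H) \<inter> (if k then K else - K) \<noteq> {}"
    using assms unfolding logically_independent_def by simp
  then show ?thesis by (auto split: if_splits)
qed

text \<open>
  The choice of the distribution is governed by what can be avoided: mass outside \<open>H\<close> balances
  everything but \<open>B|K\<close>, mass on \<open>H - K\<close> leaves the conjunction void, and only when neither \<open>A|H\<close>
  nor \<open>B|K\<close> is bet on must the mass enter \<open>H \<inter> K\<close>.
\<close>

lemma coherent_iterated_family_iff:
  fixes A B H K :: "'w set"
  assumes ind: "logically_independent A B H K"
  defines "X1 \<equiv> Cond (A \<parallel> H)" and "X2 \<equiv> Cond (B \<parallel> K)"
    and "X3 \<equiv> Cond ((A \<parallel> H) \<and>\<^sub>B (B \<parallel> K))" and "X4 \<equiv> (B \<parallel> K) |\<^sub>B (A \<parallel> H)"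
  shows "coherent {X1, X2, X3, X4} m \<longleftrightarrow>
    m X1 \<in> {0..1} \<and> m X2 \<in> {0..1} \<and> m X3 \<in> {0..1} \<and> m X3 = m X1 * m X4 \<and>
    (m X1 = 0 \<longrightarrow> m X4 \<in> {0..1})"
    (is "?coh \<longleftrightarrow> ?cond")
proof
  note defs = X1_def X2_def X3_def X4_def
  note pt = logically_independentD[OF ind]
  assume coh: ?coh
  have ne: "H \<noteq> {}" "K \<noteq> {}" "H \<inter> K \<noteq> {}" "A \<inter> H \<inter> K \<noteq> {}"
    using pt[of True True True True] by auto
  have "(A \<parallel> H) \<and>\<^sub>B (B \<parallel> K) \<noteq> (A \<parallel> H)"
    using pt[of True True True False] by auto
  then have prod: "m X3 = m X1 * m X4"
    unfolding defs by (intro coherent_product_rule[OF coh]) (use ne in \<open>auto simp: defs\<close>)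
  have "m X1 \<in> {0..1}" "m X2 \<in> {0..1}" "m X3 \<in> {0..1}"
    using coherent_probability_bounds[OF coh] ne by (simp_all add: defs)
  moreover have "m X4 \<in> {0..1}" if "m X1 = 0"
    unfolding X4_def
    by (rule coherent_iterated_bounds[OF coh _ ne(4)]) (use that prod in \<open>simp_all add: defs\<close>)
  ultimately show ?cond using prod by blast
next
  note pt = logically_independentD[OF ind]
  assume cond: ?cond
  define x y z \<mu> where vals: "x = m X1" "y = m X2" "z = m X3" "\<mu> = m X4"
  have x: "0 \<le> x" "x \<le> 1" and y: "0 \<le> y" "y \<le> 1" and z: "0 \<le> z" "z \<le> 1"
    and prod: "z = x * \<mu>" and \<mu>: "x = 0 \<Longrightarrow> 0 \<le> \<mu> \<and> \<mu> \<le> 1"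
    using cond by (auto simp: vals)
  define g where "g X \<omega> = quantity m X \<omega> - m X" for X \<omega>
  have g1: "g X1 \<omega> = (if \<omega> \<in> H then (if \<omega> \<in> A then 1 - x else - x) else 0)" for \<omega>
    by (simp add: g_def vals X1_def)
  have g2: "g X2 \<omega> = (if \<omega> \<in> K then (if \<omega> \<in> B then 1 - y else - y) else 0)" for \<omega>
    by (simp add: g_def vals X2_def)
  have g3: "g X3 \<omega> = (if \<omega> \<in> H \<inter> K then (if \<omega> \<in> A \<inter> B then 1 - z else - z) else 0)" for \<omega>
    by (auto simp add: g_def vals X3_def indicator_def)
  have g4: "g X4 \<omega> = g X3 \<omega> - \<mu> * g X1 \<omega>" for \<omega>
    using iterated_net_gain[of m "B \<parallel> K" "A \<parallel> H" \<omega>] cond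
    unfolding g_def vals X1_def X3_def X4_def by simp
  note g = g1 g2 g3 g4
  have off: "called_off m X1 = - H" "called_off m X2 = - K" "called_off m X3 = - (H \<inter> K)"
    by (simp_all add: X1_def X2_def X3_def)
  have off4: "called_off m X4 = - H \<union> (- A \<inter> H \<inter> K) \<union> (if x = 1 then A \<inter> H \<inter> - K else {})
      \<union> (if x = 0 then - A \<inter> H \<inter> - K else {})"
    unfolding X4_def vals X1_def by (rule called_off_iter)
  obtain \<omega>1 where w1: "\<omega>1 \<in> A" "\<omega>1 \<in> B" "\<omega>1 \<in> H" "\<omega>1 \<in> K"
    using pt[of True True True True] by auto
  obtain \<omega>2 where w2: "\<omega>2 \<in> A" "\<omega>2 \<notin> B" "\<omega>2 \<in> H" "\<omega>2 \<in> K"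
    using pt[of True False True True] by auto
  obtain \<omega>3 where w3: "\<omega>3 \<notin> A" "\<omega>3 \<notin> B" "\<omega>3 \<in> H" "\<omega>3 \<in> K"
    using pt[of False False True True] by auto
  obtain \<omega>4 where w4: "\<omega>4 \<in> A" "\<omega>4 \<in> H" "\<omega>4 \<notin> K"
    using pt[of True True True False] by auto
  obtain \<omega>5 where w5: "\<omega>5 \<notin> A" "\<omega>5 \<in> H" "\<omega>5 \<notin> K"
    using pt[of False True True False] by auto
  obtain \<omega>6 where w6: "\<omega>6 \<in> B" "\<omega>6 \<notin> H" "\<omega>6 \<in> K"
    using pt[of True True False True] by auto
  obtain \<omega>7 where w7: "\<omega>7 \<notin> B" "\<omega>7 \<notin> H" "\<omega>7 \<in> K"
    using pt[of True False False True] by auto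
  note w = w1 w2 w3 w4 w5 w6 w7
  show ?coh
  proof (rule coherentI_balanced, unfold g_def[symmetric])
    fix J assume J: "J \<subseteq> {X1, X2, X3, X4}" "J \<noteq> {}"
    let ?balanced = "\<lambda>ps. (\<forall>(v, \<omega>) \<in> set ps. 0 \<le> v \<and> (\<exists>X\<in>J. \<omega> \<notin> called_off m X)) \<and>
        0 < (\<Sum>(v, \<omega>)\<leftarrow>ps. v) \<and> (\<forall>X\<in>J. (\<Sum>(v, \<omega>)\<leftarrow>ps. v * g X \<omega>) = 0)"
    consider (X2) "X2 \<in> J" | (X1) "X1 \<in> J" "X2 \<notin> J"
      | (X3) "J = {X3}" | (X4) "J \<subseteq> {X3, X4}" "X4 \<in> J" "x \<noteq> 0"
      | (X4_only) "J = {X4}" "x = 0" | (X3_X4) "J = {X3, X4}" "x = 0"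
      using J by blast
    then show "\<exists>ps. ?balanced ps"
    proof cases
      case X2
      have "?balanced [(y, \<omega>6), (1 - y, \<omega>7)]"
        using X2 J(1) y w by (auto simp: g off algebra_simps intro!: bexI[of _ X2])
      then show ?thesis by blast
    next
      case X1
      have "?balanced [(x, \<omega>4), (1 - x, \<omega>5)]"
        using X1 J(1) x w by (auto simp: g off algebra_simps intro!: bexI[of _ X1])
      then show ?thesis by blast
    next
      case X3
      have "?balanced [(z, \<omega>1), (1 - z, \<omega>2)]"
        using X3 z w by (auto simp: g off algebra_simps)
      then show ?thesis by blast
    next
      \<comment> \<open>Given \<open>A H\<close>, the mass \<open>x\<close> is all in \<open>K\<close>, with \<open>B\<close> of conditional probability \<open>z\<close>; the rest
        lies in \<open>H - K\<close>, where the conjunction is void.  So \<open>A\<close> has probability \<open>x\<close> given \<open>H\<close> and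
        \<open>A B\<close> has probability \<open>z\<close> given \<open>H K\<close>.\<close>
      case X4
      have "?balanced [(x * z, \<omega>1), (x * (1 - z), \<omega>2), (1 - x, \<omega>5)]"
        using X4 x z w by (auto simp: g off4 algebra_simps split: if_splits intro!: bexI[of _ X4])
      then show ?thesis by blast
    next
      case X4_only
      have "?balanced [(\<mu>, \<omega>1), (1 - \<mu>, \<omega>2)]"
        using X4_only \<mu> prod w by (auto simp: g off4 algebra_simps split: if_splits)
      then show ?thesis by blast
    next
      \<comment> \<open>Here \<open>x = z = 0\<close>, and all three gains involved vanish at a point of \<open>H \<inter> K\<close> outside \<open>A\<close>.\<close>
      case X3_X4
      have "?balanced [(1, \<omega>3)]"
        using X3_X4 prod w by (auto simp: g off)
      then show ?thesis by blast
    qed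
  qed
qed

theorem theorem15:
  fixes A B H K :: "'w set"
  assumes "logically_independent A B H K"
  shows "coherent_assessments
           (Cond (A \<parallel> H), Cond (B \<parallel> K), Cond ((A \<parallel> H) \<and>\<^sub>B (B \<parallel> K)),
            (B \<parallel> K) |\<^sub>B (A \<parallel> H)) =
         {(x, y, z, \<mu>). x \<in> {0<..1} \<and> y \<in> {0..1} \<and> z \<in> {0..1} \<and> \<mu> = z / x}
         \<union> {(0, y, 0, \<mu>) | y \<mu>. (y, \<mu>) \<in> {0..1} \<times> {0..1}}"
    (is "?L = ?R")
proof -
  let ?X1 = "Cond (A \<parallel> H)" and ?X2 = "Cond (B \<parallel> K)"
    and ?X3 = "Cond ((A \<parallel> H) \<and>\<^sub>B (B \<parallel> K))" and ?X4 = "(B \<parallel> K) |\<^sub>B (A \<parallel> H)"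
  define good :: "real \<Rightarrow> real \<Rightarrow> real \<Rightarrow> real \<Rightarrow> bool" where
    "good x y z \<mu> \<longleftrightarrow> x \<in> {0..1} \<and> y \<in> {0..1} \<and> z \<in> {0..1} \<and> z = x * \<mu> \<and>
       (x = 0 \<longrightarrow> \<mu> \<in> {0..1})" for x y z \<mu>
  have coh: "coherent {?X1, ?X2, ?X3, ?X4} m \<longleftrightarrow> good (m ?X1) (m ?X2) (m ?X3) (m ?X4)" for m
    unfolding good_def by (rule coherent_iterated_family_iff[OF assms])
  note pt = logically_independentD[OF assms]
  \<comment> \<open>Independence makes the four objects distinct, so their values can be prescribed freely.\<close>
  have dist: "A \<noteq> B" "H \<inter> K \<noteq> H" "H \<inter> K \<noteq> K"
    using pt[of True False True True] pt[of True True True False] pt[of True True False True]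
    by blast+
  have "?L = {(x, y, z, \<mu>). good x y z \<mu>}"
  proof (intro set_eqI iffI)
    fix v assume "v \<in> ?L"
    then show "v \<in> {(x, y, z, \<mu>). good x y z \<mu>}"
      using coh by (auto simp: coherent_assessments_def)
  next
    fix v assume "v \<in> {(x, y, z, \<mu>). good x y z \<mu>}"
    then obtain x y z \<mu> where v: "v = (x, y, z, \<mu>)" and "good x y z \<mu>" by auto
    define m where "m X = (if X = ?X1 then x else if X = ?X2 then y
        else if X = ?X3 then z else \<mu>)" for X
    have m: "m ?X1 = x" "m ?X2 = y" "m ?X3 = z" "m ?X4 = \<mu>"
      using dist by (auto simp: m_def)
    have "coherent {?X1, ?X2, ?X3, ?X4} m"
      unfolding coh m by fact
    with v m show "v \<in> ?L"
      unfolding coherent_assessments_def split by blast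
  qed
  also have "\<dots> = ?R"
  proof (intro set_eqI iffI)
    fix v assume "v \<in> {(x, y, z, \<mu>). good x y z \<mu>}"
    then obtain x y z \<mu> where v: "v = (x, y, z, \<mu>)" and "good x y z \<mu>" by auto
    then show "v \<in> ?R"
      unfolding good_def by (cases "x = 0") auto
  next
    fix v assume "v \<in> ?R"
    then show "v \<in> {(x, y, z, \<mu>). good x y z \<mu>}"
      unfolding good_def by auto
  qed
  finally show ?thesis .
qed

end
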